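(* Let $n\ge 1$ and let $\mathbf{u}=(u_1,\dots,u_n)\in\mathbb{R}^n$ be a nonzero vector with $0\le u_1\le\cdots\le u_n$. Then the normal fan of the parking function polytope $\mathrm{PF}(\mathbf{u})$ is a coarsening of the normal fan of $\mathrm{PF}(1,2,\dots,n)$. Equivalently, $\mathrm{PF}(\mathbf{u})$ is a deformation of $\mathrm{PF}(1,2,\dots,n)$.
   Context: For $\mathbf{u}=(u_1,\dots,u_n)$ with $0\le u_1\le\cdots\le u_n$, a vector $\mathbf{a}\in\mathbb{R}^n_{\ge0}$ with nondecreasing rearrangement $b_1\le\cdots\le b_n$ is a $\mathbf{u}$-parking function if $b_i\le u_i$ for all $i$. $\mathrm{PF}(\mathbf{u})\subset\mathbb{R}^n$ is the convex hull of all $\mathbf{u}$-parking functions (it is a polytope). For a nonempty face $F$ of a polytope $P\subset\mathbb{R}^n$, the normal cone is $\mathrm{ncone}(F,P)=\{\mathbf{w}\in\mathbb{R}^n : \mathbf{w}\cdot\mathbf{x}\ge\mathbf{w}\cdot\mathbf{y}\ \text{for all } \mathbf{x}\in F,\ \mathbf{y}\in P\}$. The normal fan $\Sigma(P)$ is the set of normal cones of $P$ at all its nonempty faces. $\Sigma(Q)$ is a coarsening of $\Sigma(P)$ if each cone in $\Sigma(Q)$ is a union of cones in $\Sigma(P)$; in that case $Q$ is called a deformation of $P$. *)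

theory Defs
  imports "HOL-Analysis.Analysis" "HOL-Combinatorics.Permutations"
begin

text \<open>
  The space R^n is \<^typ>\<open>real ^ 'n\<close> for an arbitrary finite, linearly ordered index type, so that
  n = CARD('n) and the coordinates have a first, second, ..., last one.
\<close>

definition nondecreasing_rearrangement ::
    "real ^ 'n::{finite,linorder} \<Rightarrow> real ^ 'n::{finite,linorder} \<Rightarrow> bool" where
  "nondecreasing_rearrangement b a \<longleftrightarrow>
     mono (($) b) \<and> (\<exists>p. p permutes UNIV \<and> b = (\<chi> i. a $ p i))"

text \<open>The nondecreasing rearrangement exists and is unique, so the quantifier over \<open>b\<close> merely names it.\<close>

definition parking_function ::
    "real ^ 'n::{finite,linorder} \<Rightarrow> real ^ 'n::{finite,linorder} \<Rightarrow> bool" where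
  "parking_function u a \<longleftrightarrow>
     (\<forall>i. 0 \<le> a $ i) \<and>
     (\<exists>b. nondecreasing_rearrangement b a \<and> (\<forall>i. b $ i \<le> u $ i))"

definition PF :: "real ^ 'n::{finite,linorder} \<Rightarrow> (real ^ 'n::{finite,linorder}) set" where
  "PF u = convex hull {a. parking_function u a}"

text \<open>The vector (1, 2, ..., n): the position of index \<open>i\<close> is the number of indices \<open>\<le> i\<close>.\<close>

definition one_to_n :: "real ^ 'n::{finite,linorder}" where
  "one_to_n = (\<chi> i. real (card {..i}))"

definition ncone :: "'a::euclidean_space set \<Rightarrow> 'a set \<Rightarrow> 'a set" where
  "ncone F P = {w. \<forall>x\<in>F. \<forall>y\<in>P. w \<bullet> x \<ge> w \<bullet> y}"

definition normal_fan :: "'a::euclidean_space set \<Rightarrow> 'a set set" where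
  "normal_fan P = {ncone F P | F. F face_of P \<and> F \<noteq> {}}"

definition coarsening :: "'a set set \<Rightarrow> 'a set set \<Rightarrow> bool" where
  "coarsening S T \<longleftrightarrow> (\<forall>C\<in>S. \<exists>U\<subseteq>T. C = \<Union>U)"

definition deformation :: "'a::euclidean_space set \<Rightarrow> 'a set \<Rightarrow> bool" where
  "deformation Q P \<longleftrightarrow> polytope Q \<and> polytope P \<and> coarsening (normal_fan Q) (normal_fan P)"

end

theory Submission
  imports Defs
begin

text \<open>
  A linear functional \<open>w\<close> on the parking function polytope of \<open>u\<close> is maximal at the vector that puts
  the largest entries of \<open>u\<close> on the largest positive coordinates of \<open>w\<close> and 0 elsewhere, by the
  rearrangement inequality. This vector is linear in \<open>u\<close>, so the polytope is Minkowski additive in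
  \<open>u\<close>. For large \<open>c\<close> the vector \<open>v = c (1, \<dots>, n) - u\<close> is again nonnegative and nondecreasing, so
  the polytope of \<open>u\<close> is a Minkowski summand of a dilation of the polytope of \<open>(1, \<dots>, n)\<close>, and the
  normal fan of a summand is a coarsening.
\<close>

section \<open>Rearrangement inequality and sorting permutations\<close>

text \<open>Induction on the largest element \<open>b\<close>. Composing \<open>q\<close> with the
  transposition of \<open>b\<close> and \<open>q b\<close> gives a permutation \<open>r\<close> that
  fixes \<open>b\<close>, so the induction hypothesis applies to it on the remaining set. It remains
  to see that passing from \<open>q\<close> to \<open>r\<close> does not lower the sum.\<close>

lemma rearrangement_sum_le:
  fixes f g :: "'a::linorder \<Rightarrow> real"
  assumes "finite A" "mono_on A f" "mono_on A g" "q permutes A"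
  shows "(\<Sum>i\<in>A. f (q i) * g i) \<le> (\<Sum>i\<in>A. f i * g i)"
  using assms
proof (induction A arbitrary: q rule: finite_linorder_max_induct)
  case empty
  then show ?case by simp
next
  case (insert b A)
  note q = \<open>q permutes insert b A\<close>
  have bA: "b \<notin> A" using insert.hyps by auto
  have mf: "mono_on A f" and mg: "mono_on A g"
    using insert.prems by (auto simp: monotone_on_def)
  define r where "r = Transposition.transpose b (q b) \<circ> q"
  have r: "r permutes A"
    unfolding r_def using permutes_insert_lemma[OF q] .
  have IH: "(\<Sum>i\<in>A. f (r i) * g i) \<le> (\<Sum>i\<in>A. f i * g i)"
    using insert.IH[OF mf mg r] .
  show ?case
  proof (cases "q b = b")
    case True
    then have "r = q" by (auto simp: r_def)
    with IH True show ?thesis using insert.hyps bA by simp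
  next
    case False
    obtain k where k: "q k = b" "k \<in> insert b A"
      using q by (metis insertI1 permutes_surj permutes_in_image surjD)
    then have kA: "k \<in> A" "k \<noteq> b" using False by auto
    have m: "q b \<in> insert b A" using permutes_in_image[OF q] by simp
    then have fb: "f (q b) \<le> f b" "g k \<le> g b"
      using insert.prems(1,2) insert.hyps kA by (auto simp: monotone_on_def dest: less_imp_le)
    have rk: "r k = q b" by (simp add: r_def k)
    have ri: "r i = q i" if "i \<in> A - {k}" for i
    proof -
      have "q i \<noteq> q k" using that inj_eq[OF permutes_inj[OF q], of i k] by simp
      then have "q i \<noteq> b" using k(1) by simp
      moreover have "q i \<noteq> q b" using that bA inj_eq[OF permutes_inj[OF q], of i b] by auto
      ultimately show ?thesis by (simp add: r_def Transposition.transpose_def)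
    qed
    have eq: "(\<Sum>i\<in>A - {k}. f (r i) * g i) = (\<Sum>i\<in>A - {k}. f (q i) * g i)"
      by (rule sum.cong) (auto simp: ri)
    \<comment> \<open>\<open>q\<close> and \<open>r\<close> differ only at \<open>b\<close> and at
      \<open>k\<close>, the preimage of \<open>b\<close>. This product is exactly the gain from the
      exchange.\<close>
    have "0 \<le> (f b - f (q b)) * (g b - g k)" using fb by simp
    then have "f (q b) * g b + f b * g k \<le> f b * g b + f (q b) * g k"
      by (simp add: algebra_simps)
    then have "(\<Sum>i\<in>insert b A. f (q i) * g i) \<le> f b * g b + (\<Sum>i\<in>A. f (r i) * g i)"
      using insert.hyps(1) bA kA k
      by (simp add: sum.remove[of A k] eq rk)
    also have "\<dots> \<le> (\<Sum>i\<in>insert b A. f i * g i)"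
      using IH insert.hyps(1) bA by simp
    finally show ?thesis .
  qed
qed

text \<open>A permutation maximising the pairing with a strictly increasing weight must sort \<open>f\<close>, since
  swapping an inversion would increase the pairing.\<close>
lemma sorting_permutation_exists:
  fixes f :: "'a::{finite,linorder} \<Rightarrow> real"
  obtains p where "p permutes UNIV" "mono (f \<circ> p)"
proof -
  \<comment> \<open>The rank of an index is a convenient strictly increasing weight.\<close>
  define h where "h i = real (card {..i})" for i :: 'a
  have h: "h i < h j" if "i < j" for i j
    unfolding h_def using that by (auto intro!: psubset_card_mono)
  let ?S = "\<lambda>p. \<Sum>i\<in>UNIV. f (p i) * h i"
  let ?M = "?S ` {p. p permutes UNIV}"
  have M: "finite ?M" "?M \<noteq> {}" by (auto intro: permutes_id)
  then obtain p where p: "p permutes UNIV" "Max ?M = ?S p" using Max_in[OF M] by blast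
  have max: "?S q \<le> ?S p" if "q permutes UNIV" for q
    using Max_ge[OF M(1)] that unfolding p(2)[symmetric] by blast
  have "f (p i) \<le> f (p j)" if "i \<le> j" for i j
  proof (rule ccontr)
    assume c: "\<not> f (p i) \<le> f (p j)"
    with that have ij: "i < j" by (cases "i = j") auto
    let ?q = "p \<circ> Transposition.transpose i j"
    have q: "?q permutes UNIV"
      by (rule permutes_compose[OF _ p(1)]) (simp add: permutes_swap_id)
    have split: "?S r = f (r i) * h i + f (r j) * h j + (\<Sum>k\<in>- {i, j}. f (r k) * h k)" for r
    proof -
      have "?S r = (\<Sum>k\<in>{i, j}. f (r k) * h k) + (\<Sum>k\<in>- {i, j}. f (r k) * h k)"
        using sum.subset_diff[of "{i, j}" UNIV "\<lambda>k. f (r k) * h k"]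
        by (simp add: Compl_eq_Diff_UNIV add.commute)
      then show ?thesis using ij by simp
    qed
    have "(\<Sum>k\<in>- {i, j}. f (?q k) * h k) = (\<Sum>k\<in>- {i, j}. f (p k) * h k)"
      by (rule sum.cong) (auto simp: Transposition.transpose_def)
    then have "?S ?q - ?S p = (f (p i) - f (p j)) * (h j - h i)"
      unfolding split by (simp add: algebra_simps)
    also have "\<dots> > 0" using c h[OF ij] by simp
    finally show False using max[OF q] by simp
  qed
  then show thesis by (intro that[OF p(1)]) (auto simp: mono_def)
qed

section \<open>Support functions of parking function polytopes\<close>

text \<open>A point of \<open>A\<close> outside \<open>B\<close> would be strictly separated from
  \<open>B\<close>, and the negated normal of the hyperplane would take a larger value there than
  anywhere on \<open>B\<close>.\<close>

lemma subset_closed_convex_if_support_le: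
  fixes A B :: "'a::euclidean_space set"
  assumes "closed B" "convex B"
    and "\<And>w. \<exists>b\<in>B. \<forall>a\<in>A. w \<bullet> a \<le> w \<bullet> b"
  shows "A \<subseteq> B"
proof
  fix z assume z: "z \<in> A"
  show "z \<in> B"
  proof (rule ccontr)
    assume "z \<notin> B"
    then obtain w c where w: "w \<bullet> z < c" "\<forall>x\<in>B. w \<bullet> x > c"
      using separating_hyperplane_closed_point[OF assms(2,1)] by blast
    obtain b where "b \<in> B" "\<forall>a\<in>A. - w \<bullet> a \<le> - w \<bullet> b" using assms(3) by blast
    with w z show False by fastforce
  qed
qed

text \<open>Intended for a \<open>p\<close> that sorts \<open>w\<close>: then \<open>inv p i\<close>
  is the rank of coordinate \<open>i\<close> in \<open>w\<close>. Since \<open>p\<close> is chosen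
  from \<open>w\<close> alone, one \<open>p\<close> serves all vectors \<open>u\<close>, which makes
  the map linear in \<open>u\<close>.\<close>

definition greedy :: "real ^ 'n \<Rightarrow> ('n \<Rightarrow> 'n) \<Rightarrow> real ^ 'n \<Rightarrow> real ^ 'n" where
  "greedy w p u = (\<chi> i. if 0 < w $ i then u $ inv p i else 0)"

lemma greedy_add: "greedy w p (u + v) = greedy w p u + greedy w p v"
  by (simp add: greedy_def vec_eq_iff)

lemma greedy_scaleR: "greedy w p (c *\<^sub>R u) = c *\<^sub>R greedy w p u"
  by (simp add: greedy_def vec_eq_iff)

text \<open>Read in the order \<open>p\<close>, the positive coordinates of \<open>w\<close> form a
  final segment. The vector becomes zeros followed by a tail of \<open>u\<close>, which is sorted
  and bounded by \<open>u\<close>.\<close>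

lemma parking_function_greedy:
  fixes u :: "real ^ 'n::{finite,linorder}"
  assumes "\<forall>i. 0 \<le> u $ i" "mono (($) u)" "p permutes UNIV" "mono (($) w \<circ> p)"
  shows "parking_function u (greedy w p u)"
proof -
  let ?b = "\<chi> i. greedy w p u $ p i"
  have b: "?b $ i = (if 0 < w $ p i then u $ i else 0)" for i
    using permutes_inverses(2)[OF assms(3)] by (simp add: greedy_def)
  have "mono (($) ?b)"
  proof (rule monoI)
    fix i j :: 'n assume "i \<le> j"
    then have "u $ i \<le> u $ j" "w $ p i \<le> w $ p j"
      using monoD[OF assms(2)] monoD[OF assms(4)] by auto
    then show "?b $ i \<le> ?b $ j" using assms(1) unfolding b by auto
  qed
  then have "nondecreasing_rearrangement ?b (greedy w p u)"
    using assms(3) unfolding nondecreasing_rearrangement_def by blast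
  moreover have "\<forall>i. ?b $ i \<le> u $ i" using assms(1) unfolding b by simp
  moreover have "\<forall>i. 0 \<le> greedy w p u $ i" using assms(1) by (simp add: greedy_def)
  ultimately show ?thesis unfolding parking_function_def by blast
qed

lemma greedy_in_PF:
  assumes "\<forall>i. 0 \<le> u $ i" "mono (($) u)" "p permutes UNIV" "mono (($) w \<circ> p)"
  shows "greedy w p u \<in> PF u"
  unfolding PF_def using parking_function_greedy[OF assms] by (simp add: hull_inc)

lemma inner_PF_le_greedy:
  fixes u :: "real ^ 'n::{finite,linorder}"
  assumes u: "mono (($) u)" and p: "p permutes UNIV" and w: "mono (($) w \<circ> p)"
    and x: "x \<in> PF u"
  shows "w \<bullet> x \<le> w \<bullet> greedy w p u"
proof -
  define c where "c i = max 0 (w $ i)" for i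
  have "w \<bullet> a \<le> w \<bullet> greedy w p u" if "parking_function u a" for a
  proof -
    from that obtain b q where "q permutes UNIV" "b = (\<chi> i. a $ q i)" "\<forall>i. b $ i \<le> u $ i"
        and a: "\<And>i. 0 \<le> a $ i"
      unfolding parking_function_def nondecreasing_rearrangement_def by blast
    then have q: "q permutes UNIV" and le: "\<And>i. a $ q i \<le> u $ i" by simp_all
    \<comment> \<open>As \<open>a\<close> is nonnegative, replacing \<open>w\<close> by its positive
      part \<open>c\<close> can only increase the pairing.\<close>
    have "w \<bullet> a \<le> (\<Sum>i\<in>UNIV. c i * a $ i)"
      unfolding inner_vec_def c_def using a by (auto intro!: sum_mono mult_right_mono)
    also have "\<dots> = (\<Sum>i\<in>UNIV. c (q i) * a $ q i)"
      using sum.permute[OF q, of "\<lambda>i. c i * a $ i"] by (simp add: comp_def)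
    also have "\<dots> \<le> (\<Sum>i\<in>UNIV. c (q i) * u $ i)"
      using le by (intro sum_mono mult_left_mono) (auto simp: c_def)
    \<comment> \<open>Inserting \<open>p\<close> and its inverse exhibits the weights as a
      permutation of the sorted weights \<open>c \<circ> p\<close>.\<close>
    also have "\<dots> = (\<Sum>i\<in>UNIV. (c \<circ> p) ((inv p \<circ> q) i) * u $ i)"
      using permutes_inverses(1)[OF p] by simp
    also have "\<dots> \<le> (\<Sum>i\<in>UNIV. (c \<circ> p) i * u $ i)"
    proof (rule rearrangement_sum_le)
      show "mono (c \<circ> p)" using monoD[OF w] by (intro monoI) (simp add: c_def max.coboundedI2)
      show "inv p \<circ> q permutes UNIV" using permutes_compose[OF q permutes_inv[OF p]] .
    qed (use u in auto)
    also have "\<dots> = (\<Sum>i\<in>UNIV. c i * u $ inv p i)"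
      using sum.permute[OF p, of "\<lambda>i. c i * u $ inv p i"] permutes_inverses(2)[OF p]
      by (simp add: comp_def)
    \<comment> \<open>The greedy vector vanishes wherever \<open>c\<close> and \<open>w\<close>
      differ.\<close>
    also have "\<dots> = w \<bullet> greedy w p u"
      unfolding inner_vec_def greedy_def c_def by (auto intro!: sum.cong)
    finally show ?thesis .
  qed
  then have "PF u \<subseteq> {y. w \<bullet> y \<le> w \<bullet> greedy w p u}"
    unfolding PF_def by (intro hull_minimal convex_halfspace_le) auto
  with x show ?thesis by blast
qed

text \<open>The finite set \<open>?V\<close> contains a greedy maximiser for every \<open>w\<close>,
  so its hull already has the support function of the whole polytope.\<close>

lemma polytope_PF:
  fixes u :: "real ^ 'n::{finite,linorder}"
  assumes "\<forall>i. 0 \<le> u $ i" "mono (($) u)"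
  shows "polytope (PF u)"
proof -
  let ?V = "{a. parking_function u a \<and> (\<forall>i. a $ i \<in> insert 0 (range (($) u)))}"
  have "finite {a. \<forall>i. a $ i \<in> insert 0 (range (($) u))}"
  proof (rule finite_subset)
    show "{a. \<forall>i. a $ i \<in> insert 0 (range (($) u))}
        \<subseteq> vec_lambda ` (UNIV \<rightarrow>\<^sub>E insert 0 (range (($) u)))"
      by (auto intro!: image_eqI[of _ vec_lambda "vec_nth _"])
  qed (simp add: finite_PiE)
  then have V: "finite ?V" by (rule rev_finite_subset) auto
  have "PF u \<subseteq> convex hull ?V"
  proof (rule subset_closed_convex_if_support_le)
    fix w :: "real ^ 'n::{finite,linorder}"
    obtain p where p: "p permutes UNIV" "mono (($) w \<circ> p)"
      by (rule sorting_permutation_exists)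
    have "greedy w p u \<in> ?V"
      using parking_function_greedy[OF assms p] by (auto simp: greedy_def)
    then have "greedy w p u \<in> convex hull ?V" by (rule hull_inc)
    then show "\<exists>b\<in>convex hull ?V. \<forall>a\<in>PF u. w \<bullet> a \<le> w \<bullet> b"
      using inner_PF_le_greedy[OF assms(2) p] by blast
  qed (rule compact_imp_closed[OF finite_imp_compact_convex_hull[OF V]], rule convex_convex_hull)
  moreover have "convex hull ?V \<subseteq> PF u" unfolding PF_def by (rule hull_mono) auto
  ultimately show ?thesis using V unfolding polytope_def by blast
qed

section \<open>Minkowski sums and normal fans\<close>

text \<open>Both sides are compact and convex, and for each \<open>w\<close> both attain their
  maximum at the same point, because greedy vectors with common \<open>w\<close> and
  \<open>p\<close> add up.\<close>

lemma PF_minkowski_sum: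
  fixes u v t :: "real ^ 'n::{finite,linorder}"
  assumes u: "\<forall>i. 0 \<le> u $ i" "mono (($) u)"
    and v: "\<forall>i. 0 \<le> v $ i" "mono (($) v)"
    and t: "\<forall>i. 0 \<le> t $ i" "mono (($) t)"
    and c: "0 < c" "u + v = c *\<^sub>R t"
  shows "(*\<^sub>R) c ` PF t = {x + y | x y. x \<in> PF u \<and> y \<in> PF v}" (is "?L = ?R")
proof
  note cpt = polytope_imp_compact[OF polytope_PF] and cvx = polytope_imp_convex[OF polytope_PF]
  have "(\<Union>x\<in>PF u. \<Union>y\<in>PF v. {x + y}) = ?R" by blast
  with compact_sums[OF cpt[OF u] cpt[OF v]] convex_sums[OF cvx[OF u] cvx[OF v]]
  have R: "compact ?R" "convex ?R" by simp_all
  have L: "compact ?L" "convex ?L"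
    using compact_scaling[OF cpt[OF t]] convex_scaling[OF cvx[OF t]] by auto
  have eq: "c *\<^sub>R greedy w p t = greedy w p u + greedy w p v" for w :: "real ^ 'n::{finite,linorder}" and p
    by (simp add: c(2) flip: greedy_add greedy_scaleR)
  show "?L \<subseteq> ?R"
  proof (rule subset_closed_convex_if_support_le[OF compact_imp_closed[OF R(1)] R(2)])
    fix w :: "real ^ 'n::{finite,linorder}"
    obtain p where p: "p permutes UNIV" "mono (($) w \<circ> p)"
      by (rule sorting_permutation_exists)
    have "c *\<^sub>R greedy w p t \<in> ?R"
      unfolding eq using greedy_in_PF[OF u p] greedy_in_PF[OF v p] by blast
    moreover have "\<forall>a\<in>?L. w \<bullet> a \<le> w \<bullet> (c *\<^sub>R greedy w p t)"
      using inner_PF_le_greedy[OF t(2) p] c by auto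
    ultimately show "\<exists>b\<in>?R. \<forall>a\<in>?L. w \<bullet> a \<le> w \<bullet> b" by blast
  qed
  show "?R \<subseteq> ?L"
  proof (rule subset_closed_convex_if_support_le[OF compact_imp_closed[OF L(1)] L(2)])
    fix w :: "real ^ 'n::{finite,linorder}"
    obtain p where p: "p permutes UNIV" "mono (($) w \<circ> p)"
      by (rule sorting_permutation_exists)
    have "c *\<^sub>R greedy w p t \<in> ?L" using greedy_in_PF[OF t p] by blast
    moreover have "\<forall>a\<in>?R. w \<bullet> a \<le> w \<bullet> (c *\<^sub>R greedy w p t)"
      unfolding eq using inner_PF_le_greedy[OF u(2) p] inner_PF_le_greedy[OF v(2) p]
      by (auto simp: inner_add_right intro!: add_mono)
    ultimately show "\<exists>b\<in>?L. \<forall>a\<in>?R. w \<bullet> a \<le> w \<bullet> b" by blast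
  qed
qed

text \<open>For \<open>w\<close> in a cone \<open>C\<close> of \<open>Q\<close>, let
  \<open>G\<close> be the face of \<open>P\<close> on which \<open>w\<close> is maximal. Its normal
  cone contains \<open>w\<close> and lies inside \<open>C\<close>, so such cones cover
  \<open>C\<close>.\<close>

lemma coarsening_normal_fan_minkowski_summand:
  fixes P Q R :: "'a::euclidean_space set"
  assumes P: "compact P" "convex P" "P \<noteq> {}" and R: "compact R" "R \<noteq> {}" and c: "0 < c"
    and sum: "(*\<^sub>R) c ` P = {x + y | x y. x \<in> Q \<and> y \<in> R}"
  shows "coarsening (normal_fan Q) (normal_fan P)"
  unfolding coarsening_def
proof
  have attained: "\<exists>x\<in>S. \<forall>y\<in>S. w \<bullet> y \<le> w \<bullet> x" if "compact S" "S \<noteq> {}" for S and w :: 'a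
    by (rule continuous_attains_sup[OF that]) (intro continuous_intros)
  have split: "\<exists>x\<in>Q. \<exists>y\<in>R. c *\<^sub>R z = x + y" if "z \<in> P" for z
  proof -
    have "c *\<^sub>R z \<in> {x + y | x y. x \<in> Q \<and> y \<in> R}"
      unfolding sum[symmetric] using that by (rule imageI)
    then show ?thesis by blast
  qed
  have join: "\<exists>z\<in>P. x + y = c *\<^sub>R z" if "x \<in> Q" "y \<in> R" for x y
  proof -
    have "x + y \<in> (*\<^sub>R) c ` P" unfolding sum using that by blast
    then show ?thesis by blast
  qed
  fix C assume "C \<in> normal_fan Q"
  then obtain F where F: "F face_of Q" "F \<noteq> {}" and C: "C = ncone F Q"
    unfolding normal_fan_def by auto
  have "\<exists>D\<in>normal_fan P. D \<subseteq> C \<and> w \<in> D" if w: "w \<in> C" for w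
  proof -
    obtain z0 where z0: "z0 \<in> P" "\<forall>z\<in>P. w \<bullet> z \<le> w \<bullet> z0" using attained[OF P(1,3)] by blast
    define G where "G = P \<inter> {z. w \<bullet> z = w \<bullet> z0}"
    have G: "G face_of P" unfolding G_def
      using face_of_Int_supporting_hyperplane_le[OF P(2)] z0(2) by blast
    have "G \<noteq> {}" using z0 by (auto simp: G_def)
    with G have D: "ncone G P \<in> normal_fan P" unfolding normal_fan_def by blast
    have wG: "w \<in> ncone G P" using z0 by (auto simp: G_def ncone_def)
    have "w' \<in> C" if w': "w' \<in> ncone G P" for w'
      unfolding C ncone_def
    proof (intro CollectI ballI)
      fix x x' assume x: "x \<in> F" and x': "x' \<in> Q"
      have xQ: "x \<in> Q" using x F(1) face_of_imp_subset by blast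
      obtain y where y: "y \<in> R" "\<forall>y'\<in>R. w \<bullet> y' \<le> w \<bullet> y" using attained[OF R] by blast
      obtain z where z: "z \<in> P" "x + y = c *\<^sub>R z" using join[OF xQ y(1)] by blast
      obtain z' where z': "z' \<in> P" "x' + y = c *\<^sub>R z'" using join[OF x' y(1)] by blast
      obtain x0 y0 where xy0: "x0 \<in> Q" "y0 \<in> R" "c *\<^sub>R z0 = x0 + y0" using split[OF z0(1)] by blast
      have "w \<bullet> x0 \<le> w \<bullet> x" using w x xy0(1) unfolding C ncone_def by blast
      \<comment> \<open>\<open>x\<close> maximises \<open>w\<close> on \<open>Q\<close> and
        \<open>y\<close> on \<open>R\<close>, so \<open>x + y\<close> does at least as well as the
        decomposition of the maximiser \<open>z0\<close>. Hence \<open>z\<close> lies in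
        \<open>G\<close>.\<close>
      then have "w \<bullet> (c *\<^sub>R z0) \<le> w \<bullet> (c *\<^sub>R z)"
        using y(2) xy0(2)
        unfolding xy0(3) z(2)[symmetric] by (simp add: inner_add_right add_mono)
      then have "w \<bullet> z0 \<le> w \<bullet> z" using c by simp
      then have "z \<in> G" using z(1) z0(2) by (simp add: G_def antisym)
      then have "w' \<bullet> z' \<le> w' \<bullet> z" using w' z' unfolding ncone_def by blast
      then have "w' \<bullet> (c *\<^sub>R z') \<le> w' \<bullet> (c *\<^sub>R z)" using c by simp
      \<comment> \<open>Both sums use the same \<open>y\<close>, so its contribution
        cancels.\<close>
      then show "w' \<bullet> x' \<le> w' \<bullet> x"
        by (simp add: z(2)[symmetric] z'(2)[symmetric] inner_add_right del: inner_scaleR_right)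
    qed
    with D wG show ?thesis by blast
  qed
  then have "C = \<Union>{D \<in> normal_fan P. D \<subseteq> C}" by blast
  then show "\<exists>U\<subseteq>normal_fan P. C = \<Union>U"
    by (intro exI[of _ "{D \<in> normal_fan P. D \<subseteq> C}"]) simp
qed

theorem proposition1p1:
  fixes u :: "real ^ 'n::{finite,linorder}"
  assumes "u \<noteq> 0"
    and "\<forall>i. 0 \<le> u $ i"
    and "mono (($) u)"
  shows "coarsening (normal_fan (PF u)) (normal_fan (PF (one_to_n :: real ^ 'n::{finite,linorder})))
       \<and> deformation (PF u) (PF (one_to_n :: real ^ 'n::{finite,linorder}))"
proof -
  let ?t = "one_to_n :: real ^ 'n::{finite,linorder}"
  \<comment> \<open>\<open>c\<close> must be positive and bound every entry of \<open>u\<close>;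
    this makes \<open>v\<close> below nonnegative and nondecreasing.\<close>
  define c where "c = norm u + 1"
  define v where "v = c *\<^sub>R ?t - u"
  have c: "0 < c" by (simp add: c_def add_nonneg_pos)
  have uc: "u $ i \<le> c" for i
    using component_le_norm_cart[of u i] by (simp add: c_def)
  have t_ge: "1 \<le> ?t $ i" for i
    by (auto simp: one_to_n_def Suc_le_eq card_gt_0_iff)
  have t_step: "?t $ i + 1 \<le> ?t $ j" if "i < j" for i j
  proof -
    have "card {..i} < card {..j}" using that by (auto intro!: psubset_card_mono)
    then show ?thesis by (simp add: one_to_n_def)
  qed
  have "0 \<le> ?t $ i" for i using t_ge[of i] by simp
  moreover have "?t $ i \<le> ?t $ j" if "i < j" for i j using t_step[OF that] by simp
  ultimately have t: "\<forall>i. 0 \<le> ?t $ i" "mono (($) ?t)"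
    by (auto simp: mono_def order_le_less)
  have "0 \<le> v $ i" for i
  proof -
    have "u $ i \<le> c * 1" using uc by simp
    also have "\<dots> \<le> c * ?t $ i" using t_ge c by (intro mult_left_mono) auto
    finally show ?thesis by (simp add: v_def)
  qed
  \<comment> \<open>From \<open>i\<close> to \<open>j\<close>, \<open>c *\<^sub>R ?t\<close> grows
    by at least \<open>c\<close>, whereas \<open>u\<close> grows by at most \<open>u $ j\<close>,
    which is at most \<open>c\<close>.\<close>
  moreover have "v $ i \<le> v $ j" if "i < j" for i j
    using mult_left_mono[OF t_step[OF that], of c] c uc[of j] assms(2)[rule_format, of i]
    by (simp add: v_def algebra_simps)
  ultimately have v: "\<forall>i. 0 \<le> v $ i" "mono (($) v)"
    by (auto simp: mono_def order_le_less)
  \<comment> \<open>For \<open>w = 0\<close> the identity sorts, and the greedy vector is the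
    origin.\<close>
  have ne: "PF x \<noteq> {}" if "\<forall>i. 0 \<le> x $ i" "mono (($) x)" for x :: "real ^ 'n::{finite,linorder}"
    using greedy_in_PF[OF that permutes_id, of 0] by (auto simp: mono_def)
  note pt = polytope_PF[OF t] and pv = polytope_PF[OF v]
  have "coarsening (normal_fan (PF u)) (normal_fan (PF ?t))"
    by (rule coarsening_normal_fan_minkowski_summand[OF polytope_imp_compact[OF pt]
          polytope_imp_convex[OF pt] ne[OF t] polytope_imp_compact[OF pv] ne[OF v] c
          PF_minkowski_sum[OF assms(2,3) v t c]]) (simp add: v_def)
  then show ?thesis
    using polytope_PF[OF assms(2,3)] pt by (simp add: deformation_def)
qed

end
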